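(* Let $\lambda$ be a positive integer, let $V$ be a set of $n$ vertices and let $a: V \rightarrow \mathbb{Z}$ and $b: V \rightarrow \mathbb{Z}$ be functions such that $a(v) \geq b(v) \geq 0$ for each $v \in V$ and $\sum_{v \in V}a(v)=\lambda\binom{n}{2}$. There exists a $\lambda$-fold tournament $T$ on $V$ such that $\deg^+_T(v) = a(v)$ and $|N^+_T(v)| \geq b(v)$ for each $v \in V$ if and only if, for each $k \in \{0,\ldots,n-1\}$, $$\psi_k+\sum_{v \in V}b_k(v) \leq \tfrac{1}{2}\lambda k(2n-k-1),$$ where $b_k(v)=\max(0,b(v)-n+k+1)$ for each $v \in V$ and $\psi_k$ is the sum of the greatest $k$ elements of the multiset $\{a(v)-b_k(v): v \in V\}$.
   Context: $\lambda K_V$ is the $\lambda$-fold complete multigraph on vertex set $V$ (exactly $\lambda$ edges between each pair of distinct vertices, no loops). A $\lambda$-fold tournament on $V$ is a graph produced by orienting (each of) the edges of $\lambda K_V$. For a vertex $v$ of an oriented multigraph $G$, $\deg^+_G(v)$ is the number of edges incident with $v$ and oriented out from it, and $N^+_G(v)$ is the set of all $w\in V(G)$ for which there is at least one edge of $G$ oriented from $v$ to $w$. *)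

theory Defs
  imports Complex_Main "HOL-Library.Multiset" "Graph_Theory.Digraph"
begin

(* The edges of the complete multigraph of multiplicity lam on V: the lam parallel edges
   joining the ends of a two-element set e are told apart by an index i < lam. *)
definition complete_multigraph_edges :: "nat \<Rightarrow> 'a set \<Rightarrow> ('a set \<times> nat) set" where
  "complete_multigraph_edges lam V = {e. e \<subseteq> V \<and> card e = 2} \<times> {..<lam}"

(* An orientation keeps every edge and selects which of its two ends is the tail;
   the functions tail and head are unconstrained outside the arc set. *)
definition fold_tournament ::
    "nat \<Rightarrow> 'a set \<Rightarrow> ('a, 'a set \<times> nat) pre_digraph \<Rightarrow> bool" where
  "fold_tournament lam V T \<longleftrightarrow>
     verts T = V \<and> arcs T = complete_multigraph_edges lam V \<and>
     (\<forall>e \<in> arcs T. {tail T e, head T e} = fst e)"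

definition out_neighbours :: "('a, 'b) pre_digraph \<Rightarrow> 'a \<Rightarrow> 'a set" where
  "out_neighbours G v = {w \<in> verts G. v \<rightarrow>\<^bsub>G\<^esub> w}"

definition b_trunc :: "('a \<Rightarrow> int) \<Rightarrow> nat \<Rightarrow> nat \<Rightarrow> 'a \<Rightarrow> int" where
  "b_trunc b n k v = max 0 (b v - int n + int k + 1)"

(* Equal elements are counted with multiplicity; if the multiset has fewer than k elements,
   all of them are summed. *)
definition sum_greatest :: "nat \<Rightarrow> int multiset \<Rightarrow> int" where
  "sum_greatest k M = sum_list (take k (rev (sorted_list_of_multiset M)))"

definition psi :: "'a set \<Rightarrow> ('a \<Rightarrow> int) \<Rightarrow> ('a \<Rightarrow> int) \<Rightarrow> nat \<Rightarrow> nat \<Rightarrow> int" where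
  "psi V a b n k = sum_greatest k (image_mset (\<lambda>v. a v - b_trunc b n k v) (mset_set V))"

lemma fold_tournament_loopfree_fin_digraph:
  assumes "fold_tournament lam V T" "finite V"
  shows "loopfree_digraph T" "fin_digraph T"
proof -
  have ends: "{tail T e, head T e} \<subseteq> verts T \<and> card {tail T e, head T e} = 2"
    if "e \<in> arcs T" for e
    using assms(1) that by (auto simp: fold_tournament_def complete_multigraph_edges_def)
  have "finite (arcs T)"
    using assms finite_subset[of "{e. e \<subseteq> V \<and> card e = 2}" "Pow V"]
    by (auto simp: fold_tournament_def complete_multigraph_edges_def)
  moreover have "finite (verts T)"
    using assms by (simp add: fold_tournament_def)
  moreover have "wf_digraph T"
    using ends by unfold_locales auto
  moreover have "tail T e \<noteq> head T e" if "e \<in> arcs T" for e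
    using ends[OF that] by auto
  ultimately show "loopfree_digraph T" "fin_digraph T"
    by (auto simp: loopfree_digraph_def loopfree_digraph_axioms_def
        fin_digraph_def fin_digraph_axioms_def)
qed

lemma fold_tournament_card_joining:
  assumes "fold_tournament lam V T" "u \<in> V" "v \<in> V" "u \<noteq> v"
  shows "card {e \<in> arcs T. {tail T e, head T e} = {u, v}} = lam"
proof -
  have "{e \<in> arcs T. {tail T e, head T e} = {u, v}} = {e \<in> arcs T. fst e = {u, v}}"
    using assms(1) by (intro Collect_cong conj_cong refl) (simp add: fold_tournament_def)
  also have "\<dots> = {{u, v}} \<times> {..<lam}"
    using assms by (auto simp: fold_tournament_def complete_multigraph_edges_def)
  finally show ?thesis
    by (simp add: card_cartesian_product)
qed

end

theory Submission
  imports Defs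
begin

text \<open>
  The condition is a Hall-type cut condition. By \<open>psi_condition_iff\<close> it says that, for each
  proper subset \<open>S\<close> of \<open>V\<close> with \<open>k\<close> elements,
  \<open>\<Sum>v\<in>S. a v + \<Sum>v\<in>V - S. b_k v\<close> is at most the number of edges meeting \<open>S\<close>: maximising the left
  side over all \<open>S\<close> of size \<open>k\<close> produces \<open>\<psi>\<^sub>k\<close>.

  Necessity is a count of edges meeting \<open>S\<close>. Those directed out of vertices of \<open>S\<close> number
  \<open>\<Sum>v\<in>S. a v\<close>, and a vertex outside \<open>S\<close> has only \<open>n - k - 1\<close> possible
  out-neighbours outside \<open>S\<close>, so it sends at least \<open>b_k v\<close> further edges into \<open>S\<close>
  (\<open>fold_tournament_cut_bound\<close>).

  For sufficiency, regard a tournament as a way to distribute the \<open>lam\<close> edges on each pair of vertices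
  among the two ends, an end receiving the edges that it is the tail of. Split the demand \<open>a v\<close> of a vertex
  into \<open>b v\<close> special units, of which each pair may supply at most one, and \<open>a v - b v\<close> ordinary
  units. A distribution that meets all demands is an integral transportation from vertices to pairs; the
  special units of \<open>v\<close> then point to \<open>b v\<close> distinct out-neighbours, and since the total demand
  equals the total number of edges, every edge is used. So it is enough to verify the cut condition of the
  capacitated transportation theorem (\<open>transportation\<close>). A set of demands consists of the special units of a
  set \<open>P\<close> and the ordinary units of a set \<open>Q\<close>. If \<open>lam \<ge> 2\<close>, a pair that avoids \<open>Q\<close> can
  serve both of its ends in \<open>P\<close>, and the cut condition becomes the hypothesis for \<open>S = Q\<close>. If
  \<open>lam = 1\<close> it cannot, but it serves one unit as soon as it meets \<open>P \<union> Q\<close>, and because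
  \<open>b \<le> a\<close> the hypothesis for \<open>S = P \<union> Q\<close> suffices (\<open>demand_le_pair_capacity\<close>).
\<close>

section \<open>Integral transportation with capacities\<close>

text \<open>
  The value \<open>cut_capacity Y d c A\<close> bounds what the suppliers \<open>Y\<close>, with stocks \<open>d\<close>, can send
  to the consumers \<open>A\<close> along lines of capacity \<open>c\<close>.
\<close>
definition cut_capacity :: "'y set \<Rightarrow> ('y \<Rightarrow> nat) \<Rightarrow> ('x \<Rightarrow> 'y \<Rightarrow> nat) \<Rightarrow> 'x set \<Rightarrow> nat" where
  "cut_capacity Y d c A = (\<Sum>y\<in>Y. min (d y) (\<Sum>x\<in>A. c x y))"

text \<open>
  Each summand truncates a monotone modular function of \<open>A\<close> at a constant, and such truncations are
  submodular.
\<close>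
lemma cut_capacity_submodular:
  assumes "finite A" "finite B"
  shows "cut_capacity Y d c (A \<union> B) + cut_capacity Y d c (A \<inter> B)
    \<le> cut_capacity Y d c A + cut_capacity Y d c B"
proof -
  have "min (d y) (\<Sum>x\<in>A \<union> B. c x y) + min (d y) (\<Sum>x\<in>A \<inter> B. c x y)
      \<le> min (d y) (\<Sum>x\<in>A. c x y) + min (d y) (\<Sum>x\<in>B. c x y)" for y
  proof -
    have "(\<Sum>x\<in>A \<union> B. c x y) + (\<Sum>x\<in>A \<inter> B. c x y) = (\<Sum>x\<in>A. c x y) + (\<Sum>x\<in>B. c x y)"
      using assms by (rule sum.union_inter)
    moreover have "(\<Sum>x\<in>A \<inter> B. c x y) \<le> (\<Sum>x\<in>A. c x y)"
      "(\<Sum>x\<in>A \<inter> B. c x y) \<le> (\<Sum>x\<in>B. c x y)"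
      using assms by (auto intro!: sum_mono2)
    ultimately show ?thesis by linarith
  qed
  then show ?thesis
    unfolding cut_capacity_def sum.distrib[symmetric] by (intro sum_mono)
qed

text \<open>
  Lowering one capacity by one lowers the capacity of a cut by at most one. Hence, if the demand \<open>m\<close>
  of \<open>A\<close> could be met before and cannot be met afterwards, it was met with equality, and the lowered line
  contributed fully, that is, the stock at \<open>y\<close> was not the bottleneck.
\<close>
lemma cut_capacity_decrement:
  fixes c :: "'x \<Rightarrow> 'y \<Rightarrow> nat"
  assumes "finite A" "finite Y" "y \<in> Y" "c x y > 0"
    and violated: "cut_capacity Y d (c(x := (c x)(y := c x y - 1))) A < m"
    and "m \<le> cut_capacity Y d c A"
  shows "x \<in> A" and "m = cut_capacity Y d c A" and "(\<Sum>z\<in>A. c z y) \<le> d y"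
proof -
  let ?c = "c(x := (c x)(y := c x y - 1))"
  have off: "(\<Sum>z\<in>A. ?c z y') = (\<Sum>z\<in>A. c z y')" if "y' \<noteq> y" for y'
    using that by (intro sum.cong) auto
  have split: "cut_capacity Y d c' A = min (d y) (\<Sum>z\<in>A. c' z y) +
      (\<Sum>y'\<in>Y - {y}. min (d y') (\<Sum>z\<in>A. c' z y'))" for c' :: "'x \<Rightarrow> 'y \<Rightarrow> nat"
    unfolding cut_capacity_def using assms by (intro sum.remove) auto
  have rest: "(\<Sum>y'\<in>Y - {y}. min (d y') (\<Sum>z\<in>A. ?c z y')) =
      (\<Sum>y'\<in>Y - {y}. min (d y') (\<Sum>z\<in>A. c z y'))"
    by (intro sum.cong refl arg_cong2[where f = min] off) auto
  show "x \<in> A"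
  proof (rule ccontr)
    assume "x \<notin> A"
    then have "(\<Sum>z\<in>A. ?c z y) = (\<Sum>z\<in>A. c z y)"
      by (intro sum.cong) auto
    then show False
      using split[of ?c] split[of c] rest assms by simp
  qed
  then have "(\<Sum>z\<in>A. c' z y) = c' x y + (\<Sum>z\<in>A - {x}. c' z y)" for c' :: "'x \<Rightarrow> 'y \<Rightarrow> nat"
    using assms by (intro sum.remove) auto
  from this[of c] this[of ?c] have "(\<Sum>z\<in>A. c z y) = (\<Sum>z\<in>A. ?c z y) + 1"
    using assms by simp
  then show "m = cut_capacity Y d c A" and "(\<Sum>z\<in>A. c z y) \<le> d y"
    using split[of ?c] split[of c] rest assms by linarith+
qed

text \<open>
  If no positive capacity can be lowered without violating the cut condition, then the capacities
  themselves are a transportation. The argument follows Rado's proof of Hall's theorem. Each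
  positive \<open>c x y\<close> lies in a tight set in which the stock at \<open>y\<close> is not exceeded. Tight sets are
  closed under intersection by submodularity, so there is a smallest tight set \<open>A\<close> containing \<open>x\<close>, and
  no stock that \<open>x\<close> draws on is exceeded in it. Removing \<open>x\<close> from \<open>A\<close> therefore
  lowers the cut capacity by the whole row sum of \<open>x\<close>, so that row sum is at most \<open>s x\<close>. Then
  the column bounds follow from the cut condition for \<open>X\<close>.
\<close>
lemma irreducible_capacities_are_transportation:
  fixes c :: "'x \<Rightarrow> 'y \<Rightarrow> nat"
  assumes fin: "finite X" "finite Y"
    and cut: "\<And>A. A \<subseteq> X \<Longrightarrow> sum s A \<le> cut_capacity Y d c A"
    and irreducible: "\<And>x y. x \<in> X \<Longrightarrow> y \<in> Y \<Longrightarrow> c x y > 0 \<Longrightarrow>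
      \<exists>A\<subseteq>X. cut_capacity Y d (c(x := (c x)(y := c x y - 1))) A < sum s A"
  shows "(\<forall>x\<in>X. (\<Sum>y\<in>Y. c x y) = s x) \<and> (\<forall>y\<in>Y. (\<Sum>x\<in>X. c x y) \<le> d y)"
proof -
  let ?R = "cut_capacity Y d c"
  define tight where "tight A \<longleftrightarrow> A \<subseteq> X \<and> sum s A = ?R A" for A
  have finA: "finite A" if "A \<subseteq> X" for A
    using that fin finite_subset by blast
  have tight_Int: "tight (A \<inter> B)" if "tight A" "tight B" for A B
  proof -
    have sub: "A \<subseteq> X" "B \<subseteq> X"
      using that by (auto simp: tight_def)
    have "sum s (A \<union> B) + sum s (A \<inter> B) = sum s A + sum s B"
      using sub by (intro sum.union_inter finA)
    moreover have "?R (A \<union> B) + ?R (A \<inter> B) \<le> ?R A + ?R B"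
      using sub by (intro cut_capacity_submodular finA)
    moreover have "sum s (A \<union> B) \<le> ?R (A \<union> B)" "sum s (A \<inter> B) \<le> ?R (A \<inter> B)"
      using sub by (auto intro!: cut)
    moreover have "A \<inter> B \<subseteq> X" using sub by auto
    ultimately show ?thesis
      using that unfolding tight_def by linarith
  qed
  have witness: "\<exists>A. tight A \<and> x \<in> A \<and> (\<Sum>z\<in>A. c z y) \<le> d y"
    if xy: "x \<in> X" "y \<in> Y" "c x y > 0" for x y
  proof -
    obtain A where A: "A \<subseteq> X" "cut_capacity Y d (c(x := (c x)(y := c x y - 1))) A < sum s A"
      using irreducible[OF xy] by blast
    note dec = cut_capacity_decrement[OF finA[OF A(1)] fin(2) xy(2,3) A(2) cut[OF A(1)]]
    show ?thesis
      using A(1) dec by (auto simp: tight_def)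
  qed
  have row: "(\<Sum>y\<in>Y. c x y) = s x" if x: "x \<in> X" for x
  proof (rule antisym)
    have "s x \<le> ?R {x}"
      using cut[of "{x}"] x by simp
    also have "\<dots> \<le> (\<Sum>y\<in>Y. c x y)"
      unfolding cut_capacity_def by (intro sum_mono) simp
    finally show "s x \<le> (\<Sum>y\<in>Y. c x y)" .
    show "(\<Sum>y\<in>Y. c x y) \<le> s x"
    proof (cases "\<exists>A. tight A \<and> x \<in> A")
      case False
      then have "c x y = 0" if "y \<in> Y" for y
        using witness[OF x that] by auto
      then show ?thesis by simp
    next
      case True
      \<comment> \<open>A tight set of minimum size, hence contained in all others that contain \<open>x\<close>.\<close>
      define A where "A = (ARG_MIN card A. tight A \<and> x \<in> A)"
      have A: "tight A" "x \<in> A"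
        using arg_min_natI[of "\<lambda>A. tight A \<and> x \<in> A"] True unfolding A_def by blast+
      have A_le: "card A \<le> card B" if "tight B" "x \<in> B" for B
        using arg_min_nat_le[of "\<lambda>A. tight A \<and> x \<in> A" B card] that unfolding A_def by blast
      have AX: "A \<subseteq> X" using A by (simp add: tight_def)
      have A_sub: "A \<subseteq> B" if "tight B" "x \<in> B" for B
      proof -
        have "card A \<le> card (A \<inter> B)"
          using A that by (intro A_le tight_Int) auto
        then have "A \<inter> B = A"
          using finA[OF AX] by (intro card_seteq) auto
        then show ?thesis by auto
      qed
      have drop: "min (d y) (\<Sum>z\<in>A. c z y) = c x y + min (d y) (\<Sum>z\<in>A - {x}. c z y)"
        if y: "y \<in> Y" for y
      proof -
        have eq: "(\<Sum>z\<in>A. c z y) = c x y + (\<Sum>z\<in>A - {x}. c z y)"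
          using A finA[OF AX] by (intro sum.remove) auto
        show ?thesis
        proof (cases "c x y = 0")
          case False
          then obtain B where B: "tight B" "x \<in> B" "(\<Sum>z\<in>B. c z y) \<le> d y"
            using witness[OF x y] by auto
          have "(\<Sum>z\<in>A. c z y) \<le> (\<Sum>z\<in>B. c z y)"
            using A_sub[OF B(1,2)] B(1) finA by (intro sum_mono2) (auto simp: tight_def)
          then show ?thesis using B(3) eq by simp
        qed (use eq in simp)
      qed
      have "sum s A = ?R A"
        using A by (simp add: tight_def)
      also have "\<dots> = (\<Sum>y\<in>Y. c x y) + ?R (A - {x})"
        unfolding cut_capacity_def sum.distrib[symmetric] by (intro sum.cong refl drop)
      \<comment> \<open>Tightness of \<open>A\<close> and the cut condition for \<open>A - {x}\<close> leave at most \<open>s x\<close> for the row.\<close>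
      finally have "(\<Sum>y\<in>Y. c x y) + ?R (A - {x}) = sum s A" by simp
      moreover have "sum s A = s x + sum s (A - {x})"
        using A finA[OF AX] by (intro sum.remove) auto
      moreover have "sum s (A - {x}) \<le> ?R (A - {x})"
        using AX by (intro cut) auto
      ultimately show ?thesis by linarith
    qed
  qed
  moreover have "(\<Sum>x\<in>X. c x y) \<le> d y" if y: "y \<in> Y" for y
  proof (rule ccontr)
    assume over: "\<not> (\<Sum>x\<in>X. c x y) \<le> d y"
    have "?R X < (\<Sum>y\<in>Y. \<Sum>x\<in>X. c x y)"
      unfolding cut_capacity_def by (rule sum_strict_mono_ex1) (use fin y over in \<open>auto intro!: bexI[of _ y]\<close>)
    also have "\<dots> = (\<Sum>x\<in>X. \<Sum>y\<in>Y. c x y)"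
      by (rule sum.swap)
    also have "\<dots> = sum s X"
      using row by simp
    finally show False
      using cut[of X] by simp
  qed
  ultimately show ?thesis by blast
qed

text \<open>
  The discrete supply-demand theorem. Capacities can be lowered one unit at a time as long as the
  cut condition survives; when this is no longer possible, they form a solution.
\<close>
lemma transportation:
  fixes c :: "'x \<Rightarrow> 'y \<Rightarrow> nat"
  assumes fin: "finite X" "finite Y"
    and cut: "\<And>A. A \<subseteq> X \<Longrightarrow> sum s A \<le> cut_capacity Y d c A"
  shows "\<exists>f. (\<forall>x y. f x y \<le> c x y) \<and> (\<forall>x\<in>X. (\<Sum>y\<in>Y. f x y) = s x)
    \<and> (\<forall>y\<in>Y. (\<Sum>x\<in>X. f x y) \<le> d y)"
  using cut
proof (induction "\<Sum>x\<in>X. \<Sum>y\<in>Y. c x y" arbitrary: c rule: less_induct)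
  case less
  let ?dec = "\<lambda>x y. c(x := (c x)(y := c x y - 1))"
  show ?case
  proof (cases "\<exists>x\<in>X. \<exists>y\<in>Y. c x y > 0 \<and> (\<forall>A\<subseteq>X. sum s A \<le> cut_capacity Y d (?dec x y) A)")
    case True
    then obtain x y where xy: "x \<in> X" "y \<in> Y" "c x y > 0"
      and keeps: "\<And>A. A \<subseteq> X \<Longrightarrow> sum s A \<le> cut_capacity Y d (?dec x y) A"
      by blast
    have le: "?dec x y u w \<le> c u w" for u w by simp
    have "(\<Sum>u\<in>X. \<Sum>w\<in>Y. ?dec x y u w) < (\<Sum>u\<in>X. \<Sum>w\<in>Y. c u w)"
    proof (rule sum_strict_mono_ex1)
      show "\<forall>u\<in>X. (\<Sum>w\<in>Y. ?dec x y u w) \<le> (\<Sum>w\<in>Y. c u w)"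
        using le by (intro ballI sum_mono)
      have "(\<Sum>w\<in>Y. ?dec x y x w) < (\<Sum>w\<in>Y. c x w)"
        by (rule sum_strict_mono_ex1) (use fin xy le in auto)
      then show "\<exists>u\<in>X. (\<Sum>w\<in>Y. ?dec x y u w) < (\<Sum>w\<in>Y. c u w)"
        using xy by blast
    qed (use fin in auto)
    from less.hyps[OF this keeps] obtain f where f: "\<forall>u w. f u w \<le> ?dec x y u w"
      "\<forall>x\<in>X. (\<Sum>y\<in>Y. f x y) = s x" "\<forall>y\<in>Y. (\<Sum>x\<in>X. f x y) \<le> d y"
      by blast
    have "f u w \<le> c u w" for u w
      using f(1) le order_trans by blast
    with f show ?thesis by blast
  next
    case False
    have "(\<forall>x\<in>X. (\<Sum>y\<in>Y. c x y) = s x) \<and> (\<forall>y\<in>Y. (\<Sum>x\<in>X. c x y) \<le> d y)"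
    proof (rule irreducible_capacities_are_transportation[OF fin less.prems])
      show "\<exists>A\<subseteq>X. cut_capacity Y d (?dec x y) A < sum s A"
        if "x \<in> X" "y \<in> Y" "c x y > 0" for x y
        using False that by (meson not_le)
    qed
    then show ?thesis by blast
  qed
qed

section \<open>Two-element subsets\<close>

abbreviation (input) pairs :: "'a set \<Rightarrow> 'a set set" where
  "pairs V \<equiv> {e. e \<subseteq> V \<and> card e = 2}"

text \<open>
  The predicate \<open>Q\<close> lets the rule apply to \<open>pairs V\<close> and to its subsets given by a further
  condition.
\<close>
lemma finite_pairs: "finite V \<Longrightarrow> finite {e. e \<subseteq> V \<and> Q e}"
  by (rule finite_subset[of _ "Pow V"]) auto

lemma card_pairs_containing:
  assumes "finite V" "v \<in> V"
  shows "card {e \<in> pairs V. v \<in> e} = card V - 1"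
proof -
  have "{e \<in> pairs V. v \<in> e} = (\<lambda>w. {v, w}) ` (V - {v})"
    using assms by (auto simp: card_2_iff doubleton_eq_iff)
  moreover have "inj_on (\<lambda>w. {v, w}) (V - {v})"
    by (auto simp: inj_on_def doubleton_eq_iff)
  ultimately show ?thesis
    using assms by (simp add: card_image)
qed

lemma two_times_choose_two: "2 * int (n choose 2) = int n * (int n - 1)"
proof -
  have "even (n * (n - 1))" by (cases n) simp_all
  then have "2 * (n choose 2) = n * (n - 1)"
    by (simp add: choose_two)
  then have "2 * int (n choose 2) = int (n * (n - 1))"
    by (metis of_nat_mult of_nat_numeral)
  then show ?thesis
    by (cases n) (auto simp: algebra_simps)
qed

text \<open>
  The pairs avoiding \<open>S\<close> are the pairs of \<open>V - S\<close>, so the number sought is a difference of two binomial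
  coefficients; multiplied by \<open>lam\<close>, it is the bound in the theorem.
\<close>
lemma card_pairs_meeting:
  assumes "finite V" "S \<subseteq> V"
  shows "2 * int (card {e \<in> pairs V. e \<inter> S \<noteq> {}}) = int (card S) * (2 * int (card V) - int (card S) - 1)"
proof -
  have fS: "finite S" using assms finite_subset by blast
  have le: "card S \<le> card V" using assms card_mono by blast
  have "card (pairs V) = card ({e \<in> pairs V. e \<inter> S \<noteq> {}} \<union> pairs (V - S))"
    by (rule arg_cong[where f = card]) auto
  also have "\<dots> = card {e \<in> pairs V. e \<inter> S \<noteq> {}} + card (pairs (V - S))"
    using finite_pairs[OF assms(1)] finite_pairs[of "V - S"] assms(1)
    by (intro card_Un_disjoint) auto
  finally have "card (pairs V) = card {e \<in> pairs V. e \<inter> S \<noteq> {}} + card (pairs (V - S))" .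
  moreover have "card (V - S) = card V - card S"
    using assms fS by (simp add: card_Diff_subset)
  ultimately have "int (card {e \<in> pairs V. e \<inter> S \<noteq> {}}) =
      int (card V choose 2) - int ((card V - card S) choose 2)"
    using assms by (simp add: n_subsets)
  then show ?thesis
    using two_times_choose_two[of "card V"] two_times_choose_two[of "card V - card S"] le
    by (simp add: of_nat_diff algebra_simps)
qed

section \<open>The cut form of the condition\<close>

text \<open>
  Sorting \<open>V\<close> by \<open>f\<close> yields a set of \<open>k\<close> vertices realising the greatest values; the
  threshold property is what makes its sum maximal.
\<close>
lemma sum_greatest_attained:
  fixes f :: "'a \<Rightarrow> int"
  assumes "finite V" "k \<le> card V"
  shows "\<exists>S\<subseteq>V. card S = k \<and> sum_greatest k (image_mset f (mset_set V)) = sum f S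
    \<and> (\<forall>s\<in>S. \<forall>t\<in>V - S. f t \<le> f s)"
proof -
  obtain ys where ys: "set ys = V" "distinct ys"
    using finite_distinct_list[OF assms(1)] by blast
  define xs where "xs = rev (sort_key f ys)"
  have xs: "set xs = V" "distinct xs"
    using ys by (auto simp: xs_def)
  have len: "length xs = card V"
    using distinct_card[OF xs(2)] xs(1) by simp
  have "mset_set V = mset ys"
    using mset_set_set[OF ys(2)] ys(1) by simp
  then have "image_mset f (mset_set V) = mset (map f ys)"
    by simp
  then have "sorted_list_of_multiset (image_mset f (mset_set V)) = sort (map f ys)"
    by (simp only: sorted_list_of_multiset_mset)
  also have "\<dots> = map f (sort_key f ys)"
    by (intro properties_for_sort) auto
  finally have list: "rev (sorted_list_of_multiset (image_mset f (mset_set V))) = map f xs"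
    by (simp add: xs_def rev_map)
  have desc: "sorted_wrt (\<lambda>x y. f y \<le> f x) xs"
    using sorted_sort_key[of f ys] unfolding xs_def sorted_wrt_rev sorted_map by simp
  let ?S = "set (take k xs)"
  have "V - ?S \<subseteq> set (drop k xs)"
    unfolding xs(1)[symmetric] by (subst (1) append_take_drop_id[of k xs, symmetric]) (auto simp del: append_take_drop_id)
  moreover have "sorted_wrt (\<lambda>x y. f y \<le> f x) (take k xs @ drop k xs)"
    using desc by simp
  then have "\<forall>s\<in>?S. \<forall>t\<in>set (drop k xs). f t \<le> f s"
    unfolding sorted_wrt_append by blast
  ultimately have "\<forall>s\<in>?S. \<forall>t\<in>V - ?S. f t \<le> f s"
    by blast
  moreover have "sum_greatest k (image_mset f (mset_set V)) = sum f ?S"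
    using xs by (simp add: sum_greatest_def list take_map sum_list_distinct_conv_sum_set)
  moreover have "card ?S = k"
    using xs len assms by (simp add: distinct_card)
  moreover have "?S \<subseteq> V"
    using xs(1) set_take_subset[of k xs] by simp
  ultimately show ?thesis by blast
qed

text \<open>
  An exchange argument: let \<open>S\<close> carry the greatest values. Every value on \<open>S - A\<close> is at least the
  maximum \<open>m\<close> on \<open>A - S\<close>, and the two differences have equal size.
\<close>
lemma sum_le_sum_greatest:
  fixes f :: "'a \<Rightarrow> int"
  assumes "finite V" "A \<subseteq> V"
  shows "sum f A \<le> sum_greatest (card A) (image_mset f (mset_set V))"
proof -
  have "card A \<le> card V" using assms card_mono by blast
  then obtain S where S: "S \<subseteq> V" "card S = card A"
    "sum_greatest (card A) (image_mset f (mset_set V)) = sum f S"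
    and top: "\<And>s t. s \<in> S \<Longrightarrow> t \<in> V - S \<Longrightarrow> f t \<le> f s"
    using sum_greatest_attained[OF assms(1), of "card A" f] by blast
  have fin: "finite A" "finite S"
    using finite_subset[OF assms(2,1)] finite_subset[OF S(1) assms(1)] .
  have card_eq: "card (A - S) = card (S - A)"
    using fin S(2) by (intro le_antisym card_le_sym_Diff) auto
  have "sum f (A - S) \<le> sum f (S - A)"
  proof (cases "A - S = {}")
    case True
    then have "card (A - S) = 0" by (simp only: card.empty)
    then have "S - A = {}" using card_eq fin by simp
    then show ?thesis unfolding True by (simp only: order_refl)
  next
    case False
    define m where "m = Max (f ` (A - S))"
    have "m \<in> f ` (A - S)"
      unfolding m_def using fin False by (intro Max_in) auto
    then have "m \<le> f s" if "s \<in> S - A" for s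
      using top that assms(2) by auto
    then have "of_nat (card (S - A)) * m \<le> sum f (S - A)"
      by (intro sum_bounded_below) auto
    moreover have "sum f (A - S) \<le> of_nat (card (A - S)) * m"
      by (rule sum_bounded_above) (use fin in \<open>auto simp: m_def\<close>)
    ultimately show ?thesis using card_eq by simp
  qed
  moreover have "sum f A = sum f (A - S) + sum f (A \<inter> S)"
    using sum.Int_Diff[OF fin(1), of f S] by simp
  moreover have "sum f S = sum f (S - A) + sum f (A \<inter> S)"
    using sum.Int_Diff[OF fin(2), of f A] by (simp add: Int_commute)
  ultimately show ?thesis using S(3) by simp
qed

text \<open>
  Since \<open>\<psi>\<^sub>k\<close> is the maximum of the sums of \<open>a - b_k\<close> over the \<open>k\<close>-subsets \<open>S\<close>, adding
  \<open>b_k\<close> over all of \<open>V\<close> leaves \<open>a\<close> on \<open>S\<close> and \<open>b_k\<close> outside.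
\<close>
lemma psi_condition_iff:
  fixes a b :: "'a \<Rightarrow> int"
  assumes "finite V" "card V = n" "k \<le> n"
  shows "real_of_int (psi V a b n k + (\<Sum>v\<in>V. b_trunc b n k v))
            \<le> 1 / 2 * real lam * real k * (2 * real n - real k - 1)
    \<longleftrightarrow> (\<forall>S\<subseteq>V. card S = k \<longrightarrow> (\<Sum>v\<in>S. a v) + (\<Sum>v\<in>V - S. b_trunc b n k v)
            \<le> int (lam * card {e \<in> pairs V. e \<inter> S \<noteq> {}}))" (is "?L \<longleftrightarrow> ?R")
proof -
  let ?f = "\<lambda>v. a v - b_trunc b n k v"
  have split: "sum ?f S + (\<Sum>v\<in>V. b_trunc b n k v) =
      (\<Sum>v\<in>S. a v) + (\<Sum>v\<in>V - S. b_trunc b n k v)" if "S \<subseteq> V" for S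
    using sum.subset_diff[OF that assms(1), of "b_trunc b n k"] by (simp add: sum_subtractf)
  have rhs: "1 / 2 * real lam * real k * (2 * real n - real k - 1) =
      of_int (int (lam * card {e \<in> pairs V. e \<inter> S \<noteq> {}}))" if "S \<subseteq> V" "card S = k" for S
  proof -
    have "real_of_int (2 * int (card {e \<in> pairs V. e \<inter> S \<noteq> {}})) =
        real_of_int (int k * (2 * int n - int k - 1))"
      using card_pairs_meeting[OF assms(1) that(1)] that(2) assms(2) by simp
    then have twice: "2 * real (card {e \<in> pairs V. e \<inter> S \<noteq> {}}) = real k * (2 * real n - real k - 1)"
      by simp
    have "1 / 2 * real lam * real k * (2 * real n - real k - 1) =
        real lam / 2 * (real k * (2 * real n - real k - 1))"
      by simp
    then show ?thesis
      unfolding twice[symmetric] by simp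
  qed
  obtain S where S: "S \<subseteq> V" "card S = k" "psi V a b n k = sum ?f S"
    using sum_greatest_attained[OF assms(1), of k ?f] assms(2,3) unfolding psi_def by auto
  show ?thesis
  proof
    assume L: ?L
    show ?R
    proof (intro allI impI)
      fix S assume S: "S \<subseteq> V" "card S = k"
      have "sum ?f S \<le> psi V a b n k"
        using sum_le_sum_greatest[OF assms(1) S(1), of ?f] S(2) by (simp add: psi_def)
      then have "(\<Sum>v\<in>S. a v) + (\<Sum>v\<in>V - S. b_trunc b n k v)
          \<le> psi V a b n k + (\<Sum>v\<in>V. b_trunc b n k v)"
        using split[OF S(1)] by linarith
      moreover have "psi V a b n k + (\<Sum>v\<in>V. b_trunc b n k v)
          \<le> int (lam * card {e \<in> pairs V. e \<inter> S \<noteq> {}})"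
        using L unfolding rhs[OF S] of_int_le_iff .
      ultimately show "(\<Sum>v\<in>S. a v) + (\<Sum>v\<in>V - S. b_trunc b n k v)
          \<le> int (lam * card {e \<in> pairs V. e \<inter> S \<noteq> {}})"
        by (rule order_trans)
    qed
  next
    assume ?R
    then show ?L
      using S split[OF S(1)] unfolding rhs[OF S(1,2)] of_int_le_iff by simp
  qed
qed

section \<open>Necessity\<close>

text \<open>
  The sets \<open>D v\<close> in the proof, namely all arcs leaving \<open>v\<close> for \<open>v \<in> S\<close> and the arcs from \<open>v\<close>
  into \<open>S\<close> otherwise, are disjoint and consist of edges meeting \<open>S\<close>.
\<close>
lemma fold_tournament_cut_bound:
  fixes T :: "('a, 'a set \<times> nat) pre_digraph" and b :: "'a \<Rightarrow> int"
  assumes "fold_tournament lam V T" "finite V" "card V = n" "S \<subseteq> V" "card S = k" "k < n"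
    and nbrs: "\<And>v. v \<in> V \<Longrightarrow> b v \<le> int (card (out_neighbours T v))"
  shows "(\<Sum>v\<in>S. int (out_degree T v)) + (\<Sum>v\<in>V - S. b_trunc b n k v)
    \<le> int (lam * card {e \<in> pairs V. e \<inter> S \<noteq> {}})"
proof -
  have verts: "verts T = V" and arcs: "arcs T = pairs V \<times> {..<lam}"
    and ends: "\<And>e. e \<in> arcs T \<Longrightarrow> {tail T e, head T e} = fst e"
    using assms(1) by (auto simp: fold_tournament_def complete_multigraph_edges_def)
  have fin_arcs: "finite (arcs T)"
    unfolding arcs using finite_pairs[OF assms(2)] by simp
  have fS: "finite S" using assms finite_subset by blast
  define D where "D v = {e \<in> arcs T. tail T e = v \<and> (v \<in> S \<or> head T e \<in> S)}" for v
  have finD: "finite (D v)" for v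
    unfolding D_def using fin_arcs by simp
  have inS: "int (out_degree T v) = int (card (D v))" if "v \<in> S" for v
    using that by (simp add: out_degree_def out_arcs_def D_def)
  have outS: "b_trunc b n k v \<le> int (card (D v))" if v: "v \<in> V - S" for v
  proof -
    have "out_neighbours T v \<subseteq> head T ` D v \<union> (V - S - {v})"
    proof
      fix w assume "w \<in> out_neighbours T v"
      then obtain e where e: "w \<in> V" "e \<in> arcs T" "tail T e = v" "head T e = w"
        by (auto simp: out_neighbours_def verts arcs_ends_conv)
      have "card (fst e) = 2" using e(2) arcs by auto
      then have "card {v, w} = 2" unfolding ends[OF e(2), symmetric] e(3,4) .
      then have "w \<noteq> v" by auto
      then show "w \<in> head T ` D v \<union> (V - S - {v})"
        using e by (auto simp: D_def)
    qed
    then have "card (out_neighbours T v) \<le> card (head T ` D v \<union> (V - S - {v}))"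
      using finD assms(2) by (intro card_mono) auto
    also have "\<dots> \<le> card (head T ` D v) + card (V - S - {v})"
      by (rule card_Un_le)
    also have "\<dots> \<le> card (D v) + (n - k - 1)"
      using card_image_le[OF finD, of "head T" v] v assms fS
      by (simp add: card_Diff_subset)
    finally show ?thesis
      using nbrs[of v] v \<open>k < n\<close> by (simp add: b_trunc_def of_nat_diff)
  qed
  have "(\<Sum>v\<in>S. int (out_degree T v)) + (\<Sum>v\<in>V - S. b_trunc b n k v)
      \<le> (\<Sum>v\<in>S. int (card (D v))) + (\<Sum>v\<in>V - S. int (card (D v)))"
    using inS outS by (intro add_mono sum_mono) auto
  also have "\<dots> = (\<Sum>v\<in>V. int (card (D v)))"
    using sum.subset_diff[OF assms(4,2)] by (metis add.commute)
  also have "\<dots> = int (card (\<Union>v\<in>V. D v))"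
    using assms(2) finD by (subst card_UN_disjoint) (auto simp: D_def)
  also have "\<dots> \<le> int (card ({e \<in> pairs V. e \<inter> S \<noteq> {}} \<times> {..<lam}))"
  proof -
    have "D v \<subseteq> {e \<in> pairs V. e \<inter> S \<noteq> {}} \<times> {..<lam}" for v
    proof
      fix e assume "e \<in> D v"
      then have "e \<in> arcs T" "fst e \<inter> S \<noteq> {}"
        using ends[of e] unfolding D_def by blast+
      then show "e \<in> {e \<in> pairs V. e \<inter> S \<noteq> {}} \<times> {..<lam}"
        by (auto simp: arcs)
    qed
    then have "(\<Union>v\<in>V. D v) \<subseteq> {e \<in> pairs V. e \<inter> S \<noteq> {}} \<times> {..<lam}"
      by (rule UN_least)
    then show ?thesis
      using assms(2) by (intro of_nat_mono card_mono finite_SigmaI) (auto simp: finite_pairs)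
  qed
  finally show ?thesis
    by (simp add: card_cartesian_product mult.commute)
qed

section \<open>Tournaments from shares\<close>

text \<open>
  Only the number \<open>g v e\<close> of parallel edges on the pair \<open>e\<close> that leave the end \<open>v\<close> matters: name the ends
  \<open>p e\<close> and \<open>q e\<close>, and direct the first \<open>g (p e) e\<close> copies out of \<open>p e\<close> and the others out of
  \<open>q e\<close>.
\<close>
lemma fold_tournament_of_shares:
  fixes g :: "'a \<Rightarrow> 'a set \<Rightarrow> nat"
  assumes "finite V" and shares: "\<And>e. e \<in> pairs V \<Longrightarrow> (\<Sum>v\<in>e. g v e) = lam"
  shows "\<exists>T :: ('a, 'a set \<times> nat) pre_digraph. fold_tournament lam V T \<and>
    (\<forall>v\<in>V. out_degree T v = (\<Sum>e | e \<in> pairs V \<and> v \<in> e. g v e) \<and>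
      card (out_neighbours T v) = card {e \<in> pairs V. v \<in> e \<and> g v e > 0})"
proof -
  have "\<forall>e\<in>pairs V. \<exists>u w. e = {u, w} \<and> u \<noteq> w"
    by (auto simp: card_2_iff)
  then obtain p q where pq: "\<And>e. e \<in> pairs V \<Longrightarrow> e = {p e, q e} \<and> p e \<noteq> q e"
    by metis
  define T :: "('a, 'a set \<times> nat) pre_digraph" where
    "T = \<lparr>verts = V, arcs = pairs V \<times> {..<lam},
      tail = (\<lambda>(e, i). if i < g (p e) e then p e else q e),
      head = (\<lambda>(e, i). if i < g (p e) e then q e else p e)\<rparr>"
  have tour: "fold_tournament lam V T"
    unfolding fold_tournament_def complete_multigraph_edges_def
  proof (intro conjI ballI)
    fix e assume "e \<in> arcs T"
    then have "fst e \<in> pairs V" by (auto simp: T_def)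
    then have "{p (fst e), q (fst e)} = fst e"
      using pq by blast
    then show "{tail T e, head T e} = fst e"
      by (simp add: T_def split_beta insert_commute)
  qed (auto simp: T_def)
  have arcs: "arcs T = pairs V \<times> {..<lam}"
    by (simp add: T_def)
  have ends: "{tail T (e, i), head T (e, i)} = e" if "e \<in> pairs V" "i < lam" for e i
    using tour that unfolding fold_tournament_def arcs by auto
  have slice: "card {i. i < lam \<and> tail T (e, i) = v} = g v e" if e: "e \<in> pairs V" "v \<in> e" for e v
  proof -
    have ppq: "e = {p e, q e}" "p e \<noteq> q e" using pq[OF e(1)] by blast+
    then have sum: "g (p e) e + g (q e) e = lam"
    proof -
      have "(\<Sum>v\<in>{p e, q e}. g v e) = lam"
        using shares[OF e(1)] ppq(1) by simp
      then show ?thesis using ppq(2) by simp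
    qed
    show ?thesis
    proof (cases "v = p e")
      case True
      then have "{i. i < lam \<and> tail T (e, i) = v} = {..<g (p e) e}"
        using sum ppq(2) by (auto simp: T_def)
      then show ?thesis using True by simp
    next
      case False
      then have "v = q e" using e(2) ppq(1) by blast
      then have "{i. i < lam \<and> tail T (e, i) = v} = {g (p e) e..<lam}"
        using sum ppq(2) by (auto simp: T_def)
      then show ?thesis using sum \<open>v = q e\<close> by simp
    qed
  qed
  have tail_in: "tail T (e, i) \<in> e" if "e \<in> pairs V" for e i
  proof -
    have "p e \<in> e" "q e \<in> e" using pq[OF that] by blast+
    then show ?thesis by (simp add: T_def)
  qed
  have deg: "out_degree T v = (\<Sum>e | e \<in> pairs V \<and> v \<in> e. g v e)" if v: "v \<in> V" for v
  proof -
    have "out_arcs T v = Sigma {e \<in> pairs V. v \<in> e} (\<lambda>e. {i. i < lam \<and> tail T (e, i) = v})"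
      using tail_in by (fastforce simp: out_arcs_def T_def)
    then have "out_degree T v = card (Sigma {e \<in> pairs V. v \<in> e} (\<lambda>e. {i. i < lam \<and> tail T (e, i) = v}))"
      unfolding out_degree_def by (rule arg_cong)
    also have "\<dots> = (\<Sum>e | e \<in> pairs V \<and> v \<in> e. card {i. i < lam \<and> tail T (e, i) = v})"
      by (rule card_SigmaI) (auto simp: finite_pairs[OF assms(1)])
    also have "\<dots> = (\<Sum>e | e \<in> pairs V \<and> v \<in> e. g v e)"
      by (intro sum.cong refl slice) auto
    finally show ?thesis .
  qed
  have nbr: "card (out_neighbours T v) = card {e \<in> pairs V. v \<in> e \<and> g v e > 0}" if v: "v \<in> V" for v
  proof -
    have dom: "w \<in> out_neighbours T v \<longleftrightarrow> w \<in> V \<and> w \<noteq> v \<and> g v {v, w} > 0" for w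
    proof -
      have "w \<in> out_neighbours T v \<longleftrightarrow> (\<exists>i<lam. {v, w} \<in> pairs V \<and> tail T ({v, w}, i) = v)"
      proof
        assume "w \<in> out_neighbours T v"
        then obtain e i where ei: "e \<in> pairs V" "i < lam" "tail T (e, i) = v" "head T (e, i) = w"
          by (auto simp: out_neighbours_def arcs_ends_conv arcs)
        moreover from this have "e = {v, w}"
          using ends[of e i] by auto
        ultimately show "\<exists>i<lam. {v, w} \<in> pairs V \<and> tail T ({v, w}, i) = v"
          by auto
      next
        assume "\<exists>i<lam. {v, w} \<in> pairs V \<and> tail T ({v, w}, i) = v"
        then obtain i where i: "i < lam" "{v, w} \<in> pairs V" "tail T ({v, w}, i) = v"
          by blast
        then have "{v, head T ({v, w}, i)} = {v, w}"
          using ends[of "{v, w}" i] by simp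
        then have "head T ({v, w}, i) = w"
          by (auto simp: doubleton_eq_iff)
        moreover have "({v, w}, i) \<in> arcs T" using i by (simp add: arcs)
        ultimately have "(v, w) \<in> arcs_ends T"
          using i(3) unfolding arcs_ends_conv by force
        then show "w \<in> out_neighbours T v"
          using i(2) tour by (simp add: out_neighbours_def fold_tournament_def)
      qed
      also have "\<dots> \<longleftrightarrow> {v, w} \<in> pairs V \<and> {i. i < lam \<and> tail T ({v, w}, i) = v} \<noteq> {}"
        by auto
      also have "\<dots> \<longleftrightarrow> {v, w} \<in> pairs V \<and> g v {v, w} > 0"
        by (intro conj_cong refl) (subst slice[symmetric]; auto simp: card_gt_0_iff)
      finally show ?thesis using v by (auto simp: card_2_iff doubleton_eq_iff)
    qed
    have "{e \<in> pairs V. v \<in> e \<and> g v e > 0} = (\<lambda>w. {v, w}) ` out_neighbours T v"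
    proof (intro equalityI subsetI)
      fix e assume e: "e \<in> {e \<in> pairs V. v \<in> e \<and> g v e > 0}"
      then obtain w where "e = {v, w}" "w \<noteq> v"
        by (auto simp: card_2_iff)
      then show "e \<in> (\<lambda>w. {v, w}) ` out_neighbours T v"
        using e by (auto simp: dom)
    next
      fix e assume "e \<in> (\<lambda>w. {v, w}) ` out_neighbours T v"
      then show "e \<in> {e \<in> pairs V. v \<in> e \<and> g v e > 0}"
        using v by (auto simp: dom)
    qed
    moreover have "inj_on (\<lambda>w. {v, w}) (out_neighbours T v)"
      by (auto simp: inj_on_def doubleton_eq_iff)
    ultimately show ?thesis by (simp add: card_image)
  qed
  show ?thesis using tour deg nbr by blast
qed

section \<open>Sufficiency\<close>

lemma sum_bool_labelled:
  fixes h :: "'a \<times> bool \<Rightarrow> 'b :: comm_monoid_add"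
  assumes "finite A"
  shows "sum h A = (\<Sum>v | (v, True) \<in> A. h (v, True)) + (\<Sum>v | (v, False) \<in> A. h (v, False))"
proof -
  have fin: "finite {v. (v, t) \<in> A}" for t
    using assms by (rule finite_subset[rotated, OF finite_imageI[of A fst]]) force
  have "sum h A = sum h ((\<lambda>v. (v, True)) ` {v. (v, True) \<in> A} \<union> (\<lambda>v. (v, False)) ` {v. (v, False) \<in> A})"
  proof (rule arg_cong[where f = "sum h"])
    show "A = (\<lambda>v. (v, True)) ` {v. (v, True) \<in> A} \<union> (\<lambda>v. (v, False)) ` {v. (v, False) \<in> A}"
    proof (intro equalityI subsetI)
      fix x assume "x \<in> A"
      then show "x \<in> (\<lambda>v. (v, True)) ` {v. (v, True) \<in> A} \<union> (\<lambda>v. (v, False)) ` {v. (v, False) \<in> A}"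
        by (cases x; cases "snd x") auto
    qed auto
  qed
  also have "\<dots> = sum h ((\<lambda>v. (v, True)) ` {v. (v, True) \<in> A}) + sum h ((\<lambda>v. (v, False)) ` {v. (v, False) \<in> A})"
    using fin by (intro sum.union_disjoint) auto
  also have "\<dots> = (\<Sum>v | (v, True) \<in> A. h (v, True)) + (\<Sum>v | (v, False) \<in> A. h (v, False))"
    by (simp add: sum.reindex inj_on_def)
  finally show ?thesis .
qed

text \<open>
  With \<open>P\<close> the vertices with special demand and \<open>Q\<close> those with ordinary demand in a cut, the summand at
  \<open>e\<close> is the cut capacity there. For \<open>lam \<ge> 2\<close> a pair avoiding \<open>Q\<close> contributes one unit for each of
  its ends in \<open>P\<close>, and each vertex of \<open>P - Q\<close> lies in \<open>card (V - Q) - 1\<close> such pairs.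
\<close>
lemma two_fold_pair_capacity:
  assumes "finite V" "P \<subseteq> V" "Q \<subseteq> V" "2 \<le> lam"
  shows "lam * card {e \<in> pairs V. e \<inter> Q \<noteq> {}} + (card (V - Q) - 1) * card (P - Q)
    \<le> (\<Sum>e\<in>pairs V. min lam (card (e \<inter> P) + lam * card (e \<inter> Q)))"
proof -
  have fin: "finite (pairs V)" "finite (pairs (V - Q))" "finite (P - Q)"
    using assms(1) finite_subset[OF assms(2,1)] by (auto intro!: finite_pairs)
  have "(\<Sum>e\<in>pairs (V - Q). card {v \<in> P - Q. v \<in> e}) = (card (V - Q) - 1) * card (P - Q)"
  proof (rule sum_multicount[OF fin(2,3)], rule ballI)
    fix v assume "v \<in> P - Q"
    then show "card {e \<in> pairs (V - Q). v \<in> e} = card (V - Q) - 1"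
      using assms by (intro card_pairs_containing) auto
  qed
  moreover have "card {v \<in> P - Q. v \<in> e} \<le> min lam (card (e \<inter> P) + lam * card (e \<inter> Q))"
    if e: "e \<in> pairs (V - Q)" for e
  proof -
    have "card e = 2" "finite e"
      using e by (auto intro: card_ge_0_finite)
    then have "card {v \<in> P - Q. v \<in> e} \<le> card (e \<inter> P)" "card (e \<inter> P) \<le> 2"
      using card_mono[of e "e \<inter> P"] by (auto intro!: card_mono)
    then show ?thesis using assms(4) by linarith
  qed
  then have "(\<Sum>e\<in>pairs (V - Q). card {v \<in> P - Q. v \<in> e}) \<le>
      (\<Sum>e\<in>pairs (V - Q). min lam (card (e \<inter> P) + lam * card (e \<inter> Q)))"
    by (rule sum_mono)
  moreover have "(\<Sum>e\<in>{e \<in> pairs V. e \<inter> Q \<noteq> {}}. lam) \<le>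
      (\<Sum>e\<in>{e \<in> pairs V. e \<inter> Q \<noteq> {}}. min lam (card (e \<inter> P) + lam * card (e \<inter> Q)))"
  proof (rule sum_mono)
    fix e assume e: "e \<in> {e \<in> pairs V. e \<inter> Q \<noteq> {}}"
    then have "finite e" by (auto intro: card_ge_0_finite)
    then have "1 \<le> card (e \<inter> Q)" using e by (auto simp: Suc_le_eq card_gt_0_iff)
    then have "lam * 1 \<le> lam * card (e \<inter> Q)" by (rule mult_le_mono2)
    then show "lam \<le> min lam (card (e \<inter> P) + lam * card (e \<inter> Q))" by linarith
  qed
  moreover have "(\<Sum>e\<in>pairs V. min lam (card (e \<inter> P) + lam * card (e \<inter> Q))) =
      (\<Sum>e\<in>{e \<in> pairs V. e \<inter> Q \<noteq> {}}. min lam (card (e \<inter> P) + lam * card (e \<inter> Q))) +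
      (\<Sum>e\<in>pairs (V - Q). min lam (card (e \<inter> P) + lam * card (e \<inter> Q)))"
    using assms(1) by (subst sum.union_disjoint[symmetric]) (auto simp: finite_pairs intro!: sum.cong)
  ultimately show ?thesis by (simp add: mult.commute)
qed

lemma pair_capacity_ge_pairs_meeting:
  assumes "finite V" "1 \<le> lam"
  shows "card {e \<in> pairs V. e \<inter> (P \<union> Q) \<noteq> {}}
    \<le> (\<Sum>e\<in>pairs V. min lam (card (e \<inter> P) + lam * card (e \<inter> Q)))"
proof -
  have "card {e \<in> pairs V. e \<inter> (P \<union> Q) \<noteq> {}} = (\<Sum>e\<in>{e \<in> pairs V. e \<inter> (P \<union> Q) \<noteq> {}}. 1)"
    by simp
  also have "\<dots> \<le> (\<Sum>e\<in>{e \<in> pairs V. e \<inter> (P \<union> Q) \<noteq> {}}. min lam (card (e \<inter> P) + lam * card (e \<inter> Q)))"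
  proof (rule sum_mono)
    fix e assume e: "e \<in> {e \<in> pairs V. e \<inter> (P \<union> Q) \<noteq> {}}"
    then have "finite e" by (auto intro: card_ge_0_finite)
    then have "0 < card (e \<inter> P) \<or> 0 < card (e \<inter> Q)"
      using e by (auto simp: card_gt_0_iff)
    then have "0 < card (e \<inter> P) + lam * card (e \<inter> Q)"
      using assms(2) by auto
    then show "1 \<le> min lam (card (e \<inter> P) + lam * card (e \<inter> Q))"
      using assms(2) by linarith
  qed
  also have "\<dots> \<le> (\<Sum>e\<in>pairs V. min lam (card (e \<inter> P) + lam * card (e \<inter> Q)))"
    using finite_pairs[OF assms(1)] by (intro sum_mono2) auto
  finally show ?thesis .
qed

text \<open>
  The cut condition for the transportation from vertices to pairs. The special demand of vertices in
  \<open>P \<inter> Q\<close> is absorbed into \<open>\<Sum>v\<in>Q. a v\<close>. For \<open>lam = 1\<close> the hypothesis on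
  \<open>P \<union> Q\<close> applies, with \<open>b \<le> a\<close> on \<open>P - Q\<close>. For \<open>lam \<ge> 2\<close> the hypothesis on \<open>Q\<close> applies: a
  vertex of \<open>P - Q\<close> obtains up to \<open>card (V - Q) - 1\<close> special units from pairs avoiding \<open>Q\<close>, and the
  truncated function \<open>b_trunc\<close> pays for the rest.
\<close>
lemma demand_le_pair_capacity:
  fixes a b :: "'a \<Rightarrow> int"
  assumes "finite V" "1 \<le> lam" "P \<subseteq> V" "Q \<subseteq> V"
    and ab: "\<And>v. v \<in> V \<Longrightarrow> a v \<ge> b v \<and> b v \<ge> 0"
    and cuts: "\<And>S. S \<subseteq> V \<Longrightarrow> (\<Sum>v\<in>S. a v) + (\<Sum>v\<in>V - S. b_trunc b (card V) (card S) v)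
      \<le> int (lam * card {e \<in> pairs V. e \<inter> S \<noteq> {}})"
  shows "(\<Sum>v\<in>P. b v) + (\<Sum>v\<in>Q. a v - b v)
    \<le> int (\<Sum>e\<in>pairs V. min lam (card (e \<inter> P) + lam * card (e \<inter> Q)))"
proof -
  have fin: "finite P" "finite Q"
    using finite_subset[OF assms(3,1)] finite_subset[OF assms(4,1)] .
  have "(\<Sum>v\<in>P. b v) = (\<Sum>v\<in>P \<inter> Q. b v) + (\<Sum>v\<in>P - Q. b v)"
    using fin(1) by (rule sum.Int_Diff)
  moreover have "(\<Sum>v\<in>P \<inter> Q. b v) \<le> (\<Sum>v\<in>Q. b v)"
    using fin ab assms(4) by (intro sum_mono2) auto
  ultimately have demand: "(\<Sum>v\<in>P. b v) + (\<Sum>v\<in>Q. a v - b v) \<le> (\<Sum>v\<in>Q. a v) + (\<Sum>v\<in>P - Q. b v)"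
    by (simp add: sum_subtractf)
  show ?thesis
  proof (cases "lam = 1")
    case True
    have "(\<Sum>v\<in>P - Q. b v) \<le> (\<Sum>v\<in>P - Q. a v)"
      using ab assms(3) by (intro sum_mono) auto
    moreover have "(\<Sum>v\<in>P \<union> Q. a v) = (\<Sum>v\<in>Q. a v) + (\<Sum>v\<in>P - Q. a v)"
      using fin sum.union_disjoint[of Q "P - Q" a] by (simp add: Un_commute)
    moreover have "(\<Sum>v\<in>P \<union> Q. a v) + (\<Sum>v\<in>V - (P \<union> Q). b_trunc b (card V) (card (P \<union> Q)) v)
        \<le> int (lam * card {e \<in> pairs V. e \<inter> (P \<union> Q) \<noteq> {}})"
      using assms(3,4) by (intro cuts) auto
    moreover have "0 \<le> (\<Sum>v\<in>V - (P \<union> Q). b_trunc b (card V) (card (P \<union> Q)) v)"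
      by (intro sum_nonneg) (simp add: b_trunc_def)
    moreover have "int (lam * card {e \<in> pairs V. e \<inter> (P \<union> Q) \<noteq> {}})
        \<le> int (\<Sum>e\<in>pairs V. min lam (card (e \<inter> P) + lam * card (e \<inter> Q)))"
      using pair_capacity_ge_pairs_meeting[OF assms(1,2), of P Q] unfolding True
      by (simp only: mult_1 of_nat_le_iff)
    ultimately show ?thesis using demand by linarith
  next
    case False
    let ?m = "card (V - Q) - 1"
    have excess: "b v - int ?m \<le> b_trunc b (card V) (card Q) v" if v: "v \<in> P - Q" for v
    proof -
      have "card (V - Q) = card V - card Q"
        using fin assms(4) by (intro card_Diff_subset)
      moreover have "card Q < card V"
        using v assms(1,3,4) by (intro psubset_card_mono) auto
      ultimately show ?thesis by (simp add: b_trunc_def)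
    qed
    have "(\<Sum>v\<in>P - Q. b v) - int (?m * card (P - Q)) = (\<Sum>v\<in>P - Q. b v - int ?m)"
      by (simp add: sum_subtractf mult.commute)
    also have "\<dots> \<le> (\<Sum>v\<in>P - Q. b_trunc b (card V) (card Q) v)"
      using excess by (rule sum_mono)
    also have "\<dots> \<le> (\<Sum>v\<in>V - Q. b_trunc b (card V) (card Q) v)"
      using assms(1,3) by (intro sum_mono2) (auto simp: b_trunc_def)
    finally have "(\<Sum>v\<in>P - Q. b v) \<le>
        int (?m * card (P - Q)) + (\<Sum>v\<in>V - Q. b_trunc b (card V) (card Q) v)"
      by linarith
    moreover have "int (lam * card {e \<in> pairs V. e \<inter> Q \<noteq> {}} + ?m * card (P - Q))
        \<le> int (\<Sum>e\<in>pairs V. min lam (card (e \<inter> P) + lam * card (e \<inter> Q)))"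
      using assms(2) False by (intro of_nat_mono two_fold_pair_capacity[OF assms(1,3,4)]) linarith
    ultimately show ?thesis
      using demand cuts[OF assms(4)] by linarith
  qed
qed

text \<open>
  Consumers are the pairs of a vertex and a flag that is true for its special units. A line to a special
  consumer has capacity one, so distinct special units of \<open>v\<close> come from distinct pairs and
  yield distinct out-neighbours.
\<close>
lemma exists_fold_tournament_if_cuts:
  fixes a b :: "'a \<Rightarrow> int"
  assumes V: "finite V" and lam: "1 \<le> lam"
    and ab: "\<And>v. v \<in> V \<Longrightarrow> a v \<ge> b v \<and> b v \<ge> 0"
    and total: "(\<Sum>v\<in>V. a v) = int (lam * card (pairs V))"
    and cuts: "\<And>S. S \<subseteq> V \<Longrightarrow> (\<Sum>v\<in>S. a v) + (\<Sum>v\<in>V - S. b_trunc b (card V) (card S) v)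
      \<le> int (lam * card {e \<in> pairs V. e \<inter> S \<noteq> {}})"
  shows "\<exists>T :: ('a, 'a set \<times> nat) pre_digraph. fold_tournament lam V T \<and>
    (\<forall>v\<in>V. int (out_degree T v) = a v \<and> int (card (out_neighbours T v)) \<ge> b v)"
proof -
  let ?X = "V \<times> (UNIV :: bool set)" and ?Y = "pairs V"
  define s where "s = (\<lambda>(v, special). nat (if special then b v else a v - b v))"
  define c where "c = (\<lambda>(v :: 'a, special) (e :: 'a set). if v \<in> e then if special then 1 else lam else 0 :: nat)"
  have finX: "finite ?X" and finY: "finite ?Y"
    using V finite_pairs[OF V] by auto
  have cut: "sum s A \<le> cut_capacity ?Y (\<lambda>_. lam) c A" if A: "A \<subseteq> ?X" for A
  proof -
    have finA: "finite A" using A finX finite_subset by blast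
    define P where "P = {v. (v, True) \<in> A}"
    define Q where "Q = {v. (v, False) \<in> A}"
    have PQ: "P \<subseteq> V" "Q \<subseteq> V"
      using A by (auto simp: P_def Q_def)
    have finPQ: "finite P" "finite Q"
      using finite_subset[OF PQ(1) V] finite_subset[OF PQ(2) V] .
    have column: "(\<Sum>x\<in>A. c x e) = card (e \<inter> P) + lam * card (e \<inter> Q)" for e
    proof -
      have "(\<Sum>x\<in>A. c x e) = (\<Sum>v\<in>P. c (v, True) e) + (\<Sum>v\<in>Q. c (v, False) e)"
        unfolding P_def Q_def by (rule sum_bool_labelled[OF finA])
      also have "\<dots> = (\<Sum>v\<in>P \<inter> e. 1) + (\<Sum>v\<in>Q \<inter> e. lam)"
        unfolding c_def by (simp only: sum.inter_restrict[OF finPQ(1)] sum.inter_restrict[OF finPQ(2)] prod.case if_True if_False)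
      finally show ?thesis by (simp add: Int_commute mult.commute)
    qed
    have "int (sum s A) = int (\<Sum>v\<in>P. s (v, True)) + int (\<Sum>v\<in>Q. s (v, False))"
      unfolding P_def Q_def sum_bool_labelled[OF finA, of s] by simp
    also have "int (\<Sum>v\<in>P. s (v, True)) = (\<Sum>v\<in>P. b v)"
      unfolding of_nat_sum by (rule sum.cong) (use PQ ab in \<open>auto simp: s_def\<close>)
    also have "int (\<Sum>v\<in>Q. s (v, False)) = (\<Sum>v\<in>Q. a v - b v)"
      unfolding of_nat_sum by (rule sum.cong) (use PQ ab in \<open>auto simp: s_def\<close>)
    also have "(\<Sum>v\<in>P. b v) + (\<Sum>v\<in>Q. a v - b v) \<le> int (cut_capacity ?Y (\<lambda>_. lam) c A)"
      unfolding cut_capacity_def column by (rule demand_le_pair_capacity[OF V lam PQ ab cuts])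
    finally show ?thesis unfolding of_nat_le_iff .
  qed
  obtain f where f_le: "\<And>x e. f x e \<le> c x e"
    and rows: "\<And>x. x \<in> ?X \<Longrightarrow> (\<Sum>e\<in>?Y. f x e) = s x"
    and columns: "\<And>e. e \<in> ?Y \<Longrightarrow> (\<Sum>x\<in>?X. f x e) \<le> lam"
    using transportation[OF finX finY, of s "\<lambda>_. lam" c] cut by blast
  define g where "g v e = f (v, True) e + f (v, False) e" for v e
  have X_sum: "(\<Sum>x\<in>?X. h x) = (\<Sum>v\<in>V. h (v, True) + h (v, False))" for h :: "'a \<times> bool \<Rightarrow> nat"
    using sum_bool_labelled[OF finX, of h] by (simp add: sum.distrib)
  have g_off: "g v e = 0" if "v \<notin> e" for v e
    using f_le[of "(v, True)" e] f_le[of "(v, False)" e] that by (simp add: g_def c_def)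
  \<comment> \<open>Total demand equals total stock, so no edge remains undirected.\<close>
  have full: "(\<Sum>x\<in>?X. f x e) = lam" if "e \<in> ?Y" for e
  proof (rule sum_mono_inv[OF _ columns that finY])
    have "(\<Sum>e\<in>?Y. \<Sum>x\<in>?X. f x e) = (\<Sum>x\<in>?X. s x)"
      unfolding sum.swap[of _ _ ?Y] by (rule sum.cong[OF refl rows])
    also have "\<dots> = (\<Sum>v\<in>V. nat (b v) + nat (a v - b v))"
      unfolding X_sum by (simp add: s_def)
    finally have "int (\<Sum>e\<in>?Y. \<Sum>x\<in>?X. f x e) = (\<Sum>v\<in>V. int (nat (b v) + nat (a v - b v)))"
      by (simp only: of_nat_sum)
    also have "\<dots> = (\<Sum>v\<in>V. a v)"
      by (rule sum.cong) (use ab in auto)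
    finally show "(\<Sum>e\<in>?Y. \<Sum>x\<in>?X. f x e) = (\<Sum>e\<in>?Y. lam)"
      unfolding total of_nat_eq_iff by (simp add: mult.commute)
  qed
  have shares: "(\<Sum>v\<in>e. g v e) = lam" if e: "e \<in> ?Y" for e
  proof -
    have "(\<Sum>v\<in>e. g v e) = (\<Sum>v\<in>V. g v e)"
      using e V g_off by (intro sum.mono_neutral_left) auto
    also have "\<dots> = (\<Sum>x\<in>?X. f x e)"
      unfolding X_sum g_def ..
    finally show ?thesis using full[OF e] by simp
  qed
  obtain T :: "('a, 'a set \<times> nat) pre_digraph" where T: "fold_tournament lam V T"
    and deg: "\<And>v. v \<in> V \<Longrightarrow> out_degree T v = (\<Sum>e | e \<in> ?Y \<and> v \<in> e. g v e)"
    and nbr: "\<And>v. v \<in> V \<Longrightarrow> card (out_neighbours T v) = card {e \<in> ?Y. v \<in> e \<and> g v e > 0}"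
    using fold_tournament_of_shares[OF V, of g lam] shares by blast
  have "int (out_degree T v) = a v" if v: "v \<in> V" for v
  proof -
    have "out_degree T v = (\<Sum>e\<in>?Y. g v e)"
      unfolding deg[OF v] using finY g_off by (intro sum.mono_neutral_left) auto
    also have "\<dots> = s (v, True) + s (v, False)"
      unfolding g_def sum.distrib using rows v by simp
    finally show ?thesis using ab[OF v] by (simp add: s_def)
  qed
  moreover have "b v \<le> int (card (out_neighbours T v))" if v: "v \<in> V" for v
  proof -
    have "nat (b v) = (\<Sum>e\<in>?Y. f (v, True) e)"
      using rows[of "(v, True)"] v by (simp add: s_def)
    also have "\<dots> = (\<Sum>e\<in>{e \<in> ?Y. v \<in> e \<and> g v e > 0}. f (v, True) e)"
    proof (rule sum.mono_neutral_right[OF finY])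
      have "f (v, True) e = 0" if "v \<notin> e \<or> \<not> 0 < g v e" for e
        using g_off[of v e] that by (auto simp: g_def)
      then show "\<forall>e\<in>?Y - {e \<in> ?Y. v \<in> e \<and> g v e > 0}. f (v, True) e = 0"
        by blast
    qed auto
    also have "\<dots> \<le> (\<Sum>e\<in>{e \<in> ?Y. v \<in> e \<and> g v e > 0}. 1)"
    proof (rule sum_mono)
      fix e assume "e \<in> {e \<in> ?Y. v \<in> e \<and> g v e > 0}"
      then show "f (v, True) e \<le> 1"
        using f_le[of "(v, True)" e] by (simp add: c_def)
    qed
    finally show ?thesis
      using nbr[OF v] by simp
  qed
  ultimately show ?thesis using T by blast
qed

theorem theorem3:
  fixes lam n :: nat and V :: "'a set" and a b :: "'a \<Rightarrow> int"
  assumes "lam > 0"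
    and "finite V" and "card V = n"
    and "\<And>v. v \<in> V \<Longrightarrow> a v \<ge> b v \<and> b v \<ge> 0"
    and "(\<Sum>v\<in>V. a v) = int (lam * (n choose 2))"
  shows "(\<exists>T :: ('a, 'a set \<times> nat) pre_digraph. fold_tournament lam V T \<and>
            (\<forall>v\<in>V. int (out_degree T v) = a v \<and> int (card (out_neighbours T v)) \<ge> b v))
     \<longleftrightarrow> (\<forall>k<n. real_of_int (psi V a b n k + (\<Sum>v\<in>V. b_trunc b n k v))
            \<le> 1 / 2 * real lam * real k * (2 * real n - real k - 1))"
    (is "?L \<longleftrightarrow> ?R")
proof
  assume ?L
  then obtain T :: "('a, 'a set \<times> nat) pre_digraph" where T: "fold_tournament lam V T"
    and deg: "\<And>v. v \<in> V \<Longrightarrow> int (out_degree T v) = a v"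
    and nbr: "\<And>v. v \<in> V \<Longrightarrow> b v \<le> int (card (out_neighbours T v))"
    by blast
  show ?R
  proof (intro allI impI)
    fix k assume k: "k < n"
    show "real_of_int (psi V a b n k + (\<Sum>v\<in>V. b_trunc b n k v))
        \<le> 1 / 2 * real lam * real k * (2 * real n - real k - 1)"
      unfolding psi_condition_iff[OF assms(2,3) less_imp_le[OF k]]
    proof (intro allI impI)
      fix S assume S: "S \<subseteq> V" "card S = k"
      have "(\<Sum>v\<in>S. a v) = (\<Sum>v\<in>S. int (out_degree T v))"
        by (rule sum.cong) (use deg S in auto)
      then show "(\<Sum>v\<in>S. a v) + (\<Sum>v\<in>V - S. b_trunc b n k v)
          \<le> int (lam * card {e \<in> pairs V. e \<inter> S \<noteq> {}})"
        using fold_tournament_cut_bound[OF T assms(2,3) S k, of b] nbr by simp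
    qed
  qed
next
  assume R: ?R
  have card_pairs: "card (pairs V) = n choose 2"
    using n_subsets[OF assms(2), of 2] assms(3) by simp
  show ?L
  proof (rule exists_fold_tournament_if_cuts)
    show "(\<Sum>v\<in>V. a v) = int (lam * card (pairs V))"
      unfolding card_pairs by (rule assms(5))
    fix S assume S: "S \<subseteq> V"
    show "(\<Sum>v\<in>S. a v) + (\<Sum>v\<in>V - S. b_trunc b (card V) (card S) v)
        \<le> int (lam * card {e \<in> pairs V. e \<inter> S \<noteq> {}})"
    \<comment> \<open>The hypothesis covers proper subsets only; for \<open>S = V\<close> the sum of \<open>a\<close> is prescribed.\<close>
    proof (cases "S = V")
      case True
      have "{e \<in> pairs V. e \<inter> V \<noteq> {}} = pairs V"
        by (auto simp: card_2_iff)
      then show ?thesis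
        unfolding True using assms(5) card_pairs by simp
    next
      case False
      then have "card S < n"
        using S assms(2) psubset_card_mono[of V S] unfolding assms(3) by blast
      then show ?thesis
        using R psi_condition_iff[OF assms(2,3), of "card S" a b lam] S unfolding assms(3) by simp
    qed
  qed (use assms in auto)
qed

end
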